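(* Let $k\ge 1$ and let $P$ be the element of $St_{2^k}$ that has $1,\dots,k$ in the first column. Then $$D^{P}(x,t)=\frac{1-x}{1-x+(x-1)\frac{t}{k!}+\sum_{n\ge 2}\frac{((x-1)t)^n}{(kn)!}}$$ and $$A^{P}(t)=\frac{1}{1-\frac{t}{k!}+\sum_{n\ge 2}\frac{(-t)^n}{(kn)!}}.$$
   Context: $\mathcal{F}_{n,k}$ is the set of all fillings $F$ of the $k\times n$ rectangular array ($k$ rows, $n$ columns) with the integers $1,\dots,kn$, each used once, such that the elements in each column increase from bottom to top. $St_{2^k}$ is the set of standard tableaux of shape $2^k$, i.e. the elements of $\mathcal{F}_{2,k}$ whose entries also increase in each row from left to right. For a filling of a $k\times n$ array by distinct positive integers with columns increasing from bottom to top, $\mathrm{red}(F)\in\mathcal{F}_{n,k}$ is obtained by replacing the $i$-th smallest entry by $i$. $F[i,i+1]$ is the $k\times 2$ filling formed by columns $i$ and $i+1$ of $F$. For $P\in\mathcal{F}_{2,k}$, $F\in\mathcal{F}_{n,k}$ has a $P$-match starting at position $i$ ($1\le i\le n-1$) if $\mathrm{red}(F[i,i+1])=P$; $P\text{-mch}(F)$ is the number of $P$-matches in $F$, and $A^{P}_{n,k}$ is the number of $F\in\mathcal{F}_{n,k}$ with no $P$-matches. Define $$D^{P}(x,t)=1+\sum_{n\ge 1}\frac{t^n}{(kn)!}\sum_{F\in\mathcal{F}_{n,k}}x^{P\text{-mch}(F)},\qquad A^{P}(t)=D^{P}(0,t)=1+\sum_{n\ge1}\frac{A^{P}_{n,k}t^n}{(kn)!}.$$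 The identities are of formal power series in $t$ (with coefficients in $\mathbb{Q}(x)$ for the first). *)

theory Defs
  imports "HOL-Computational_Algebra.Computational_Algebra" "HOL-Library.FuncSet"
begin

text \<open>
  The cell \<open>(r, c)\<close> lies in row \<open>r\<close>, counted from the bottom, and in column \<open>c\<close>, counted from
  the left. Fillings are extensional functions, so that distinct fillings differ on some cell.
\<close>

definition cells :: "nat \<Rightarrow> nat \<Rightarrow> (nat \<times> nat) set" where
  "cells n k = {1..k} \<times> {1..n}"

definition fillings :: "nat \<Rightarrow> nat \<Rightarrow> (nat \<times> nat \<Rightarrow> nat) set" where
  "fillings n k = {F \<in> extensional (cells n k).
     bij_betw F (cells n k) {1..k * n} \<and>
     (\<forall>c\<in>{1..n}. strict_mono_on {1..k} (\<lambda>r. F (r, c)))}"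

definition standard_two_col :: "nat \<Rightarrow> (nat \<times> nat \<Rightarrow> nat) set" where
  "standard_two_col k = {P \<in> fillings 2 k. \<forall>r\<in>{1..k}. P (r, 1) < P (r, 2)}"

text \<open>When \<open>F\<close> is injective on the cells, its \<open>i\<close>-th smallest entry is the one with rank \<open>i\<close>.\<close>

definition red :: "nat \<Rightarrow> nat \<Rightarrow> (nat \<times> nat \<Rightarrow> nat) \<Rightarrow> (nat \<times> nat \<Rightarrow> nat)" where
  "red n k F = restrict (\<lambda>p. card {q \<in> cells n k. F q \<le> F p}) (cells n k)"

definition two_columns :: "nat \<Rightarrow> (nat \<times> nat \<Rightarrow> nat) \<Rightarrow> nat \<Rightarrow> (nat \<times> nat \<Rightarrow> nat)" where
  "two_columns k F i = restrict (\<lambda>(r, c). F (r, i + c - 1)) (cells 2 k)"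

definition match_at :: "nat \<Rightarrow> (nat \<times> nat \<Rightarrow> nat) \<Rightarrow> (nat \<times> nat \<Rightarrow> nat) \<Rightarrow> nat \<Rightarrow> bool" where
  "match_at k P F i \<longleftrightarrow> red 2 k (two_columns k F i) = P"

definition mch :: "nat \<Rightarrow> nat \<Rightarrow> (nat \<times> nat \<Rightarrow> nat) \<Rightarrow> (nat \<times> nat \<Rightarrow> nat) \<Rightarrow> nat" where
  "mch n k P F = card {i \<in> {1..n - 1}. match_at k P F i}"

definition avoiders :: "nat \<Rightarrow> nat \<Rightarrow> (nat \<times> nat \<Rightarrow> nat) \<Rightarrow> (nat \<times> nat \<Rightarrow> nat) set" where
  "avoiders n k P = {F \<in> fillings n k. mch n k P F = 0}"

text \<open>
  The series in \<open>t\<close> (the variable \<open>fps_X\<close>) is defined over any field of characteristic 0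
  and any \<open>x\<close> in it, so that both \<open>x\<close> an indeterminate over the rationals and \<open>x = 0\<close> are covered.
\<close>

definition D_series :: "nat \<Rightarrow> (nat \<times> nat \<Rightarrow> nat) \<Rightarrow> 'a :: field_char_0 \<Rightarrow> 'a fps" where
  "D_series k P x = Abs_fps (\<lambda>n. if n = 0 then 1
     else (\<Sum>F\<in>fillings n k. x ^ mch n k P F) / fact (k * n))"

definition A_series :: "nat \<Rightarrow> (nat \<times> nat \<Rightarrow> nat) \<Rightarrow> rat fps" where
  "A_series k P = Abs_fps (\<lambda>n. if n = 0 then 1
     else of_nat (card (avoiders n k P)) / fact (k * n))"

definition indet :: "rat poly fract" where
  "indet = to_fract [:0, 1:]"

lemma finite_fillings: "finite (fillings n k)"
proof (rule finite_subset)
  show "fillings n k \<subseteq> cells n k \<rightarrow>\<^sub>E {1..k * n}"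
    by (auto simp: fillings_def bij_betw_def PiE_def)
  show "finite (cells n k \<rightarrow>\<^sub>E {1..k * n})"
    by (rule finite_PiE) (auto simp: cells_def)
qed

lemma A_series_eq_D_series_0: "A_series k P = D_series k P 0"
proof -
  have "(\<Sum>F\<in>fillings n k. (0::rat) ^ mch n k P F) = of_nat (card (avoiders n k P))" for n
  proof -
    have "(\<Sum>F\<in>fillings n k. (0::rat) ^ mch n k P F)
        = (\<Sum>F\<in>fillings n k. if mch n k P F = 0 then 1 else 0)"
      by (rule sum.cong) (auto simp: power_0_left)
    also have "\<dots> = of_nat (card (avoiders n k P))"
      by (simp add: avoiders_def sum.If_cases finite_fillings Int_def)
    finally show ?thesis .
  qed
  then show ?thesis
    by (simp only: A_series_def D_series_def)
qed

lemma strict_mono_on_image_interval: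
  fixes f :: "nat \<Rightarrow> nat"
  assumes "strict_mono_on {1..k} f" and "f ` {1..k} = {a + 1..a + k}" and "r \<in> {1..k}"
  shows "f r = a + r"
proof -
  have mono: "f i < f j" if "1 \<le> i" "i < j" "j \<le> k" for i j
    using assms(1) that by (auto simp: strict_mono_on_def)
  have rng: "a + 1 \<le> f i" "f i \<le> a + k" if "1 \<le> i" "i \<le> k" for i
    using assms(2) that by (metis atLeastAtMost_iff imageI)+
  have lower: "i \<le> k \<Longrightarrow> a + i \<le> f i" if "1 \<le> i" for i
    using that
  proof (induction i rule: dec_induct)
    case (step i)
    then show ?case using mono[of i "Suc i"] by simp
  qed (use rng in auto)
  have upper: "1 \<le> i \<Longrightarrow> f i \<le> a + i" if "i \<le> k" for i
    using that
  proof (induction i rule: inc_induct)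
    case (step i)
    then show ?case using mono[of i "Suc i"] by simp
  qed (use rng in auto)
  show ?thesis
    using lower upper assms(3) by (force intro: antisym)
qed

lemma ex1_standard_two_col:
  "\<exists>!P. P \<in> standard_two_col k \<and> (\<lambda>r. P (r, 1)) ` {1..k} = {1..k}"
proof (rule ex1I)
  define Q where "Q = restrict (\<lambda>(r, c). (c - 1) * k + r) (cells 2 k)"
  have two: "{1..2::nat} = {1, 2}"
    by auto
  have Q1: "Q (r, Suc 0) = r" and Q2: "Q (r, 2) = k + r" if "r \<in> {1..k}" for r
    using that by (auto simp: Q_def cells_def)
  have split: "cells 2 k = (\<lambda>r. (r, 1)) ` {1..k} \<union> (\<lambda>r. (r, 2)) ` {1..k}"
    unfolding cells_def two by auto
  have "Q ` cells 2 k = (\<lambda>r. Q (r, 1)) ` {1..k} \<union> (\<lambda>r. Q (r, 2)) ` {1..k}"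
    unfolding split by (auto simp: image_Un image_image)
  also have "\<dots> = {1..k} \<union> (\<lambda>r. k + r) ` {1..k}"
    using Q1 Q2 by auto
  also have "\<dots> = {1..k * 2}"
    by (auto simp: image_iff intro: bexI[of _ "_ - k"])
  finally have img: "Q ` cells 2 k = {1..k * 2}" .
  have "card (cells 2 k) = card {1..k * 2}"
    by (simp add: cells_def)
  then have "bij_betw Q (cells 2 k) {1..k * 2}"
    using img by (simp add: bij_betw_def eq_card_imp_inj_on cells_def)
  moreover have "Q \<in> extensional (cells 2 k)"
    by (simp add: Q_def)
  ultimately show "Q \<in> standard_two_col k \<and> (\<lambda>r. Q (r, 1)) ` {1..k} = {1..k}"
    using Q1 Q2 unfolding standard_two_col_def fillings_def two
    by (auto simp: strict_mono_on_def)
  fix P assume P: "P \<in> standard_two_col k \<and> (\<lambda>r. P (r, 1)) ` {1..k} = {1..k}"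
  then have ext: "P \<in> extensional (cells 2 k)"
    and bij: "bij_betw P (cells 2 k) {1..k * 2}"
    and m1: "strict_mono_on {1..k} (\<lambda>r. P (r, 1))"
    and m2: "strict_mono_on {1..k} (\<lambda>r. P (r, 2))"
    by (auto simp: standard_two_col_def fillings_def)
  have "(\<lambda>r. P (r, 2)) ` {1..k} = P ` (cells 2 k - (\<lambda>r. (r, 1)) ` {1..k})"
    unfolding split by (auto simp: image_iff)
  also have "\<dots> = P ` cells 2 k - P ` ((\<lambda>r. (r, 1)) ` {1..k})"
    using bij by (intro inj_on_image_set_diff[of P "cells 2 k"]) (auto simp: bij_betw_def split)
  also have "\<dots> = {1..k * 2} - {1..k}"
    using bij P by (simp add: bij_betw_def image_image)
  also have "\<dots> = {k + 1..k + k}"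
    by auto
  finally have "P (r, 2) = k + r" if "r \<in> {1..k}" for r
    using strict_mono_on_image_interval[OF m2 _ that] by simp
  moreover have "P (r, 1) = r" if "r \<in> {1..k}" for r
    using strict_mono_on_image_interval[OF m1, of 0] P that by simp
  ultimately show "P = Q"
    using ext Q1 Q2 by (intro extensionalityI[of _ "cells 2 k"]) (auto simp: Q_def split)
qed

end

theory Submission
  imports Defs
begin

text \<open>
  For this \<open>P\<close> a match at \<open>i\<close> just says that the top of column \<open>i\<close> is smaller than the bottom of
  column \<open>i + 1\<close> (lemma \<open>match_at_iff_less\<close>). Write \<open>N\<^sub>n\<close> for the sum of \<open>x ^ mch F\<close> over the
  fillings with \<open>n\<close> columns, so that \<open>N\<^sub>0 = 1\<close>. Both identities say, after comparing coefficients, that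
  \[ N_n = \sum_{m=1}^{n} (x-1)^{m-1} \binom{kn}{km} N_{n-m} \qquad (n \ge 1), \]
  which is proved by inclusion-exclusion on the run of matches that ends in the last column.

  For a single filling, \<open>x ^ mch F\<close> is the sum of \<open>(x - 1) ^ (m - 1)\<close> times \<open>x\<close> to the number of
  matches inside the first \<open>n - m\<close> columns, over those \<open>m\<close> for which the last \<open>m\<close> columns are linked
  by matches (lemma \<open>power_card_run_expansion\<close>). If the last \<open>m\<close> columns are linked, they are read
  from bottom to top and left to right in increasing order, so they are determined by
  their set of \<open>km\<close> entries, and the other entries form an arbitrary filling of the first
  \<open>n - m\<close> columns (lemma \<open>sum_final_run\<close>). Since only the relative order of the entries matters,
  summing over that set gives the binomial factor (lemma \<open>sum_weight_final_run\<close>).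

  The second identity is the first one at \<open>x = 0\<close>.
\<close>

section \<open>Matches as comparisons of adjacent columns\<close>

text \<open>The set of positions at which the top entry of a column is below the bottom entry of the next
  one. Positions outside the array are not excluded, so only its members in a range matter.\<close>

definition links :: "nat \<Rightarrow> (nat \<times> nat \<Rightarrow> nat) \<Rightarrow> nat set" where
  "links k F = {i. F (k, i) < F (1, i + 1)}"

text \<open>Column-increasing fillings of the array with \<open>k\<close> rows and \<open>n\<close> columns whose entries are the
  elements of \<open>V\<close>, each used once.\<close>

definition fillings_on :: "nat set \<Rightarrow> nat \<Rightarrow> nat \<Rightarrow> (nat \<times> nat \<Rightarrow> nat) set" where
  "fillings_on V n k = {F \<in> extensional (cells n k).
     bij_betw F (cells n k) V \<and> (\<forall>c\<in>{1..n}. strict_mono_on {1..k} (\<lambda>r. F (r, c)))}"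

lemma fillings_eq_fillings_on: "fillings n k = fillings_on {1..k * n} n k"
  by (simp add: fillings_def fillings_on_def)

lemma finite_cells [simp]: "finite (cells n k)"
  by (simp add: cells_def)

lemma card_cells [simp]: "card (cells n k) = k * n"
  by (simp add: cells_def)

lemma finite_fillings_on: "finite V \<Longrightarrow> finite (fillings_on V n k)"
  by (rule finite_subset[of _ "cells n k \<rightarrow>\<^sub>E V"])
    (auto simp: fillings_on_def bij_betw_def PiE_def intro!: finite_PiE[unfolded PiE_def])

lemma red_less_iff:
  assumes "p \<in> cells n k" "q \<in> cells n k"
  shows "red n k G p < red n k G q \<longleftrightarrow> G p < G q"
proof
  assume "G p < G q"
  then have "{a \<in> cells n k. G a \<le> G p} \<subset> {a \<in> cells n k. G a \<le> G q}"
    using assms by (auto simp flip: not_le)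
  then show "red n k G p < red n k G q"
    using assms by (simp add: red_def psubset_card_mono)
next
  assume *: "red n k G p < red n k G q"
  show "G p < G q"
  proof (rule ccontr)
    assume "\<not> G p < G q"
    then have "card {a \<in> cells n k. G a \<le> G q} \<le> card {a \<in> cells n k. G a \<le> G p}"
      by (intro card_mono) auto
    with * assms show False
      by (simp add: red_def)
  qed
qed

lemma red_in_fillings:
  assumes inj: "inj_on G (cells n k)"
    and mono: "\<And>c. c \<in> {1..n} \<Longrightarrow> strict_mono_on {1..k} (\<lambda>r. G (r, c))"
  shows "red n k G \<in> fillings n k"
proof -
  have "inj_on (red n k G) (cells n k)"
  proof (rule inj_onI)
    fix p q assume pq: "p \<in> cells n k" "q \<in> cells n k" "red n k G p = red n k G q"
    then have "G p = G q"
      using red_less_iff[of p n k q G] red_less_iff[of q n k p G] by (metis less_irrefl nat_neq_iff)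
    then show "p = q"
      using inj pq by (auto dest: inj_onD)
  qed
  moreover have "red n k G ` cells n k \<subseteq> {1..k * n}"
  proof clarify
    fix a b assume p: "(a, b) \<in> cells n k"
    have "card {q \<in> cells n k. G q \<le> G (a, b)} \<le> card (cells n k)"
      by (intro card_mono) auto
    moreover have "0 < card {q \<in> cells n k. G q \<le> G (a, b)}"
      using p by (subst card_gt_0_iff) auto
    ultimately show "red n k G (a, b) \<in> {1..k * n}"
      using p by (simp add: red_def)
  qed
  ultimately have "bij_betw (red n k G) (cells n k) {1..k * n}"
    unfolding bij_betw_def by (simp add: card_subset_eq card_image)
  moreover have "strict_mono_on {1..k} (\<lambda>r. red n k G (r, c))" if "c \<in> {1..n}" for c
    using mono[OF that] that by (auto simp: strict_mono_on_def red_less_iff cells_def)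
  ultimately show ?thesis
    by (auto simp: fillings_def red_def)
qed

lemma match_at_iff_less:
  assumes k: "k \<ge> 1" and P: "P \<in> standard_two_col k"
    and P1: "(\<lambda>r. P (r, 1)) ` {1..k} = {1..k}"
    and F: "F \<in> fillings_on V n k" and i: "i \<in> {1..<n}"
  shows "match_at k P F i \<longleftrightarrow> F (k, i) < F (1, i + 1)"
proof -
  define G where "G = two_columns k F i"
  have G: "G (r, Suc 0) = F (r, i)" "G (r, 2) = F (r, Suc i)" if "r \<in> {1..k}" for r
    using that by (auto simp: G_def two_columns_def cells_def)
  have inF: "inj_on F (cells n k)"
    and mF: "\<And>c. c \<in> {1..n} \<Longrightarrow> strict_mono_on {1..k} (\<lambda>r. F (r, c))"
    using F by (auto simp: fillings_on_def bij_betw_def)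
  have mono: "strict_mono_on {1..k} (\<lambda>r. G (r, c))" if "c \<in> {1..2}" for c
  proof -
    have "c = Suc 0 \<or> c = 2" using that by auto
    then show ?thesis
      using mF[of i] mF[of "Suc i"] i by (auto simp: strict_mono_on_def G)
  qed
  have inj: "inj_on G (cells 2 k)"
  proof (rule inj_onI)
    fix p q assume pq: "p \<in> cells 2 k" "q \<in> cells 2 k" "G p = G q"
    have "F (fst p, i + snd p - 1) = F (fst q, i + snd q - 1)"
      using pq by (simp add: G_def two_columns_def case_prod_beta)
    moreover have "(fst p, i + snd p - 1) \<in> cells n k" "(fst q, i + snd q - 1) \<in> cells n k"
      using pq i by (auto simp: cells_def)
    ultimately have "(fst p, i + snd p - 1) = (fst q, i + snd q - 1)"
      using inF by (auto dest: inj_onD)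
    then show "p = q"
      using pq i by (auto simp: cells_def prod_eq_iff)
  qed
  have Gless: "G (k, 1) < G (1, 2) \<longleftrightarrow> F (k, i) < F (1, i + 1)"
    using k by (simp add: G)
  show ?thesis
  proof
    assume "match_at k P F i"
    then have red: "red 2 k G = P"
      by (simp add: match_at_def G_def)
    have inP: "inj_on P (cells 2 k)" and PV: "P (1, 2) \<in> {1..k * 2}"
      using P k by (auto simp: standard_two_col_def fillings_def bij_betw_def cells_def)
    have "P (1, 2) \<notin> (\<lambda>r. P (r, 1)) ` {1..k}"
      using inP k by (auto simp: cells_def dest!: inj_onD)
    moreover have "P (k, 1) \<in> (\<lambda>r. P (r, 1)) ` {1..k}"
      using k by simp
    ultimately have "P (k, 1) < P (1, 2)"
      using PV unfolding P1 by auto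
    then show "F (k, i) < F (1, i + 1)"
      using red_less_iff[of "(k, 1)" 2 k "(1, 2)" G] Gless k unfolding red
      by (simp add: cells_def)
  next
    assume "F (k, i) < F (1, i + 1)"
    then have less: "G (k, 1) < G (1, 2)"
      using Gless by simp
    have le1: "G (r, 1) \<le> G (s, 1) \<longleftrightarrow> r \<le> s" if "r \<in> {1..k}" "s \<in> {1..k}" for r s
      using strict_mono_on_less_eq[OF mono[of 1], of r s] that by simp
    have le2: "G (r, 2) \<le> G (s, 2) \<longleftrightarrow> r \<le> s" if "r \<in> {1..k}" "s \<in> {1..k}" for r s
      using strict_mono_on_less_eq[OF mono[of 2], of r s] that by simp
    have lt: "G (r, 1) < G (s, 2)" if "r \<in> {1..k}" "s \<in> {1..k}" for r s
      using less le1[of r k] le2[of 1 s] k that by fastforce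
    have "red 2 k G (r, 1) < red 2 k G (r, 2)" if "r \<in> {1..k}" for r
      using lt[OF that that] that by (subst red_less_iff) (auto simp: cells_def)
    then have std: "red 2 k G \<in> standard_two_col k"
      using red_in_fillings[OF inj mono] by (simp add: standard_two_col_def)
    have "red 2 k G (r, 1) = r" if r: "r \<in> {1..k}" for r
    proof -
      have "{q \<in> cells 2 k. G q \<le> G (r, 1)} = {1..r} \<times> {1}"
      proof (intro set_eqI)
        fix q :: "nat \<times> nat"
        obtain a b where q: "q = (a, b)" by force
        consider "q \<notin> cells 2 k" | "a \<in> {1..k}" "b = 1" | "a \<in> {1..k}" "b = 2"
          by (force simp: cells_def q)
        then show "q \<in> {q \<in> cells 2 k. G q \<le> G (r, 1)} \<longleftrightarrow> q \<in> {1..r} \<times> {1}"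
        proof cases
          case 1 then show ?thesis using r by (auto simp: cells_def q)
        next
          case 2 then show ?thesis using r le1[of a r] by (auto simp: cells_def q)
        next
          case 3 then show ?thesis using lt[of r a] r by (auto simp: cells_def q)
        qed
      qed
      then show ?thesis
        using r by (simp add: red_def cells_def)
    qed
    then have "(\<lambda>r. red 2 k G (r, 1)) ` {1..k} = {1..k}"
      by force
    then have "red 2 k G = P"
      using ex1_standard_two_col[of k] std P P1 by blast
    then show "match_at k P F i"
      by (simp add: match_at_def G_def)
  qed
qed

lemma mch_eq_card_links:
  assumes "k \<ge> 1" "P \<in> standard_two_col k" "(\<lambda>r. P (r, 1)) ` {1..k} = {1..k}"
    and "F \<in> fillings n k"
  shows "mch n k P F = card (links k F \<inter> {1..<n})"
proof -
  have "{i \<in> {1..n - 1}. match_at k P F i} = links k F \<inter> {1..<n}"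
    using match_at_iff_less[OF assms(1-3) assms(4)[unfolded fillings_eq_fillings_on]]
    by (auto simp: links_def)
  then show ?thesis
    by (simp add: mch_def)
qed

section \<open>Independence of the set of entries\<close>

lemma strict_mono_on_eq_nth_sorted_list:
  fixes f :: "nat \<Rightarrow> nat"
  assumes "strict_mono_on {..<n} f" "f ` {..<n} = W" "p < n"
  shows "f p = sorted_list_of_set W ! p"
proof -
  have "sorted_wrt (<) (map f [0..<n])"
    using assms(1) by (auto simp: sorted_wrt_iff_nth_less strict_mono_on_def)
  then have "sorted_list_of_set (set (map f [0..<n])) = map f [0..<n]"
    by (intro sorted_list_of_set.idem_if_sorted_distinct)
      (auto simp: strict_sorted_iff)
  moreover have "set (map f [0..<n]) = W"
    using assms(2) by (auto simp: lessThan_atLeast0)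
  ultimately show ?thesis
    using assms(3) by simp
qed

lemma nth_sorted_list_strict_mono_bij:
  fixes W :: "nat set"
  assumes "finite W"
  shows "strict_mono_on {..<card W} (\<lambda>p. sorted_list_of_set W ! p)"
    and "bij_betw (\<lambda>p. sorted_list_of_set W ! p) {..<card W} W"
proof -
  show "strict_mono_on {..<card W} (\<lambda>p. sorted_list_of_set W ! p)"
    using strict_sorted_list_of_set[of W] by (auto simp: sorted_wrt_iff_nth_less strict_mono_on_def)
  show "bij_betw (\<lambda>p. sorted_list_of_set W ! p) {..<card W} W"
    using assms by (intro bij_betw_nth) auto
qed

text \<open>The contribution of a filling when only the matches within its first \<open>n\<close> columns are counted.\<close>

definition weight :: "nat \<Rightarrow> 'a :: field_char_0 \<Rightarrow> nat \<Rightarrow> (nat \<times> nat \<Rightarrow> nat) \<Rightarrow> 'a" where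
  "weight k x n F = x ^ card (links k F \<inter> {1..<n})"

lemma relabel_fillings_on:
  assumes h: "strict_mono_on U h" "bij_betw h U V" and F: "F \<in> fillings_on U n k"
  shows "restrict (\<lambda>p. h (F p)) (cells n k) \<in> fillings_on V n k"
proof -
  have bij: "bij_betw F (cells n k) U"
    using F by (simp add: fillings_on_def)
  then have "bij_betw (h \<circ> F) (cells n k) V"
    using h(2) by (rule bij_betw_trans)
  then have "bij_betw (restrict (\<lambda>p. h (F p)) (cells n k)) (cells n k) V"
    by (rule bij_betw_cong[THEN iffD1, rotated]) simp
  moreover have "F p \<in> U" if "p \<in> cells n k" for p
    using bij that by (auto simp: bij_betw_def)
  then have "strict_mono_on {1..k} (\<lambda>r. h (F (r, c)))" if "c \<in> {1..n}" for c
    using F h(1) that by (auto simp: strict_mono_on_def fillings_on_def cells_def)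
  then have "strict_mono_on {1..k} (\<lambda>r. restrict (\<lambda>p. h (F p)) (cells n k) (r, c))"
    if "c \<in> {1..n}" for c
    using that by (auto simp: strict_mono_on_def cells_def)
  ultimately show ?thesis
    by (auto simp: fillings_on_def)
qed

lemma sum_weight_fillings_on_eq:
  assumes k: "k \<ge> 1" and V: "finite V" "card V = k * n"
  shows "(\<Sum>F\<in>fillings_on V n k. weight k x n F) = (\<Sum>F\<in>fillings n k. weight k x n F)"
proof -
  define h where "h = (\<lambda>i. sorted_list_of_set V ! (i - 1))"
  define U where "U = {1..k * n}"
  have "bij_betw (\<lambda>i. i - 1) U {..<card V}"
    by (rule bij_betw_byWitness[where f' = Suc]) (auto simp: U_def V)
  then have hb: "bij_betw h U V"
    using bij_betw_trans[OF _ nth_sorted_list_strict_mono_bij(2)[OF V(1)]]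
    by (force simp: h_def o_def)
  have hm: "strict_mono_on U h"
  proof (rule strict_mono_onI)
    fix r s assume "r \<in> U" "s \<in> U" "r < s"
    then show "h r < h s"
      using strict_mono_onD[OF nth_sorted_list_strict_mono_bij(1)[OF V(1)], of "r - 1" "s - 1"]
      by (auto simp: h_def U_def V)
  qed
  define g where "g = inv_into U h"
  have gb: "bij_betw g V U"
    unfolding g_def by (rule bij_betw_inv_into[OF hb])
  have hg: "h (g v) = v" if "v \<in> V" for v
    using hb that unfolding g_def by (auto simp: bij_betw_def f_inv_into_f)
  have gh: "g (h u) = u" if "u \<in> U" for u
    using hb that unfolding g_def by (auto simp: bij_betw_def)
  have gm: "strict_mono_on V g"
  proof (rule strict_mono_onI)
    fix v w assume vw: "v \<in> V" "w \<in> V" "v < w"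
    then have "g v \<in> U" "g w \<in> U"
      using gb by (auto simp: bij_betw_def)
    moreover have "h (g v) < h (g w)"
      using vw by (simp add: hg)
    ultimately show "g v < g w"
      using hm by (simp add: strict_mono_on_less)
  qed
  have val: "F p \<in> W" if "F \<in> fillings_on W n k" "p \<in> cells n k" for F W p
    using that by (auto simp: fillings_on_def bij_betw_def)
  have wt: "weight k x n (restrict (\<lambda>p. g (F p)) (cells n k)) = weight k x n F"
    if F: "F \<in> fillings_on V n k" for F
  proof -
    have "links k (restrict (\<lambda>p. g (F p)) (cells n k)) \<inter> {1..<n} = links k F \<inter> {1..<n}"
      using k val[OF F] gm by (auto simp: links_def cells_def strict_mono_on_less)
    then show ?thesis
      by (simp add: weight_def)
  qed
  show ?thesis
    unfolding fillings_eq_fillings_on U_def[symmetric]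
  proof (rule sum.reindex_bij_witness[of _ "\<lambda>F. restrict (\<lambda>p. h (F p)) (cells n k)"
        "\<lambda>F. restrict (\<lambda>p. g (F p)) (cells n k)"])
    fix F assume F: "F \<in> fillings_on V n k"
    have e: "F \<in> extensional (cells n k)"
      using F by (simp add: fillings_on_def)
    show "restrict (\<lambda>p. h (restrict (\<lambda>p. g (F p)) (cells n k) p)) (cells n k) = F"
      using val[OF F] hg e by (intro extensionalityI[of _ "cells n k"]) auto
    show "restrict (\<lambda>p. g (F p)) (cells n k) \<in> fillings_on U n k"
      by (rule relabel_fillings_on[OF gm gb F])
    show "weight k x n (restrict (\<lambda>p. g (F p)) (cells n k)) = weight k x n F"
      by (rule wt[OF F])
  next
    fix F assume F: "F \<in> fillings_on U n k"
    have e: "F \<in> extensional (cells n k)"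
      using F by (simp add: fillings_on_def)
    show "restrict (\<lambda>p. g (restrict (\<lambda>p. h (F p)) (cells n k) p)) (cells n k) = F"
      using val[OF F] gh e by (intro extensionalityI[of _ "cells n k"]) auto
    show "restrict (\<lambda>p. h (F p)) (cells n k) \<in> fillings_on V n k"
      by (rule relabel_fillings_on[OF hm hb F])
  qed
qed

section \<open>Fillings that end in a run of matches\<close>

text \<open>The cells of columns \<open>j + 1, \<dots>, j + m\<close>.\<close>

definition tail_cells :: "nat \<Rightarrow> nat \<Rightarrow> nat \<Rightarrow> (nat \<times> nat) set" where
  "tail_cells j m k = {1..k} \<times> {j + 1..j + m}"

text \<open>The zero-based place of a cell beyond column \<open>j\<close> when those columns are read from bottom to
  top and left to right.\<close>

definition tail_index :: "nat \<Rightarrow> nat \<Rightarrow> nat \<times> nat \<Rightarrow> nat" where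
  "tail_index j k = (\<lambda>(r, c). (c - (j + 1)) * k + (r - 1))"

text \<open>The cell at a given place of that reading order.\<close>

definition tail_cell :: "nat \<Rightarrow> nat \<Rightarrow> nat \<Rightarrow> nat \<times> nat" where
  "tail_cell j k p = (p mod k + 1, j + 1 + p div k)"

lemma cells_add: "cells (j + m) k = cells j k \<union> tail_cells j m k"
  and cells_disjoint: "cells j k \<inter> tail_cells j m k = {}"
  by (auto simp: cells_def tail_cells_def)

lemma tail_cell_index: "p \<in> tail_cells j m k \<Longrightarrow> tail_cell j k (tail_index j k p) = p"
  by (auto simp: tail_cells_def tail_index_def tail_cell_def simp del: add_diff_assoc)

lemma tail_index_cell: "k \<ge> 1 \<Longrightarrow> tail_index j k (tail_cell j k p) = p"
  by (simp add: tail_index_def tail_cell_def)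

lemma tail_index_less:
  assumes "p \<in> tail_cells j m k" shows "tail_index j k p < k * m"
proof -
  obtain r c where p: "p = (r, c)" "1 \<le> r" "r \<le> k" "j + 1 \<le> c" "c \<le> j + m"
    using assms by (auto simp: tail_cells_def)
  have "(c - (j + 1)) * k + (r - 1) < (c - (j + 1) + 1) * k"
    using p by simp
  also have "\<dots> \<le> m * k"
    using p by (intro mult_right_mono) auto
  finally show ?thesis
    by (simp add: tail_index_def p mult.commute)
qed

lemma tail_cell_mem: "p < k * m \<Longrightarrow> tail_cell j k p \<in> tail_cells j m k"
  by (cases "k = 0")
    (auto simp: tail_cells_def tail_cell_def Suc_le_eq less_mult_imp_div_less mult.commute)

lemma bij_betw_tail_index:
  assumes "k \<ge> 1" shows "bij_betw (tail_index j k) (tail_cells j m k) {..<k * m}"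
  by (rule bij_betw_byWitness[where f' = "tail_cell j k"])
    (use assms in \<open>auto simp: tail_cell_index tail_index_cell tail_index_less tail_cell_mem\<close>)

lemma bij_betw_tail_cell:
  assumes "k \<ge> 1" shows "bij_betw (tail_cell j k) {..<k * m} (tail_cells j m k)"
  by (rule bij_betw_byWitness[where f' = "tail_index j k"])
    (use assms in \<open>auto simp: tail_cell_index tail_index_cell tail_index_less tail_cell_mem\<close>)

lemma run_strict_mono:
  assumes k: "k \<ge> 1" and F: "F \<in> fillings_on U (j + m) k"
    and run: "{j + 1..<j + m} \<subseteq> links k F"
  shows "strict_mono_on {..<k * m} (\<lambda>p. F (tail_cell j k p))"
proof -
  have step: "F (tail_cell j k p) < F (tail_cell j k (Suc p))" if p: "Suc p < k * m" for p
  proof (cases "Suc p mod k = 0")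
    case True
    \<comment> \<open>The reading order passes from the top of one column to the bottom of the next.\<close>
    have "p mod k = k - 1" "Suc p div k = Suc (p div k)"
      using True k by (auto simp: mod_Suc div_Suc split: if_splits)
    moreover have "Suc (p div k) < m"
      using tail_cell_mem[OF p, of 0] calculation(2)
      by (simp add: tail_cell_def tail_cells_def)
    then have "j + 1 + p div k \<in> links k F"
      using run by auto
    ultimately show ?thesis
      using True k by (simp add: tail_cell_def links_def)
  next
    case False
    then have "Suc p mod k = Suc (p mod k)" "Suc p div k = p div k"
      using k by (auto simp: mod_Suc div_Suc split: if_splits)
    moreover have "j + 1 + p div k \<in> {1..j + m}" "Suc (Suc (p mod k)) \<in> {1..k}"
      using tail_cell_mem[OF p, of j] calculation
      by (auto simp: tail_cell_def tail_cells_def)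
    ultimately show ?thesis
      using F by (auto simp: tail_cell_def fillings_on_def strict_mono_on_def)
  qed
  show ?thesis
  proof (rule strict_mono_onI)
    fix p q assume "p \<in> {..<k * m}" "q \<in> {..<k * m}" "p < q"
    then show "F (tail_cell j k p) < F (tail_cell j k q)"
    proof (induction q)
      case (Suc q)
      then show ?case
        using step[of q] by (cases "p = q") auto
    qed simp
  qed
qed

text \<open>The unique way to put the entries of \<open>W\<close> after the \<open>j\<close> columns of \<open>G\<close> so that the new columns
  form a run of matches.\<close>

definition append_run ::
  "nat \<Rightarrow> nat \<Rightarrow> nat \<Rightarrow> nat set \<Rightarrow> (nat \<times> nat \<Rightarrow> nat) \<Rightarrow> nat \<times> nat \<Rightarrow> nat" where
  "append_run j m k W G = (\<lambda>p. if p \<in> tail_cells j m k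
     then sorted_list_of_set W ! tail_index j k p else G p)"

lemma append_run_in_fillings_on:
  assumes k: "k \<ge> 1" and V: "V \<subseteq> U" "finite U" "card (U - V) = k * m"
    and G: "G \<in> fillings_on V j k"
  shows "append_run j m k (U - V) G \<in> fillings_on U (j + m) k"
    and "{j + 1..<j + m} \<subseteq> links k (append_run j m k (U - V) G)"
proof -
  let ?F = "append_run j m k (U - V) G"
  let ?e = "\<lambda>p. sorted_list_of_set (U - V) ! p"
  note e = nth_sorted_list_strict_mono_bij[of "U - V", unfolded V(3)]
  have e_mono: "?e (tail_index j k p) < ?e (tail_index j k q)"
    if "p \<in> tail_cells j m k" "q \<in> tail_cells j m k" "tail_index j k p < tail_index j k q" for p q
    using e(1) V(2) that by (auto simp: strict_mono_on_def tail_index_less)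
  have "bij_betw (\<lambda>p. ?e (tail_index j k p)) (tail_cells j m k) (U - V)"
    using bij_betw_trans[OF bij_betw_tail_index[OF k] e(2)] V(2) by (simp add: o_def)
  then have "bij_betw ?F (tail_cells j m k) (U - V)"
    by (rule bij_betw_cong[THEN iffD1, rotated]) (simp add: append_run_def)
  moreover have "bij_betw G (cells j k) V"
    using G by (simp add: fillings_on_def)
  then have "bij_betw ?F (cells j k) V"
    by (rule bij_betw_cong[THEN iffD1, rotated])
      (use cells_disjoint in \<open>auto simp: append_run_def\<close>)
  ultimately have "bij_betw ?F (cells (j + m) k) (V \<union> (U - V))"
    unfolding cells_add by (intro bij_betw_combine) auto
  then have "bij_betw ?F (cells (j + m) k) U"
    using V(1) by (simp add: Un_absorb1)
  moreover have "?F \<in> extensional (cells (j + m) k)"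
    using G by (auto simp: extensional_def fillings_on_def append_run_def cells_add)
  moreover have "strict_mono_on {1..k} (\<lambda>r. ?F (r, c))" if c: "c \<in> {1..j + m}" for c
  proof (cases "c \<le> j")
    case True
    then have "strict_mono_on {1..k} (\<lambda>r. G (r, c))"
      using G c by (auto simp: fillings_on_def)
    then show ?thesis
      using True by (simp add: append_run_def tail_cells_def)
  next
    case False
    show ?thesis
    proof (rule strict_mono_onI)
      fix r s assume rs: "r \<in> {1..k}" "s \<in> {1..k}" "r < s"
      then have "(r, c) \<in> tail_cells j m k" "(s, c) \<in> tail_cells j m k"
        using c False by (auto simp: tail_cells_def)
      moreover have "tail_index j k (r, c) < tail_index j k (s, c)"
        using rs by (auto simp: tail_index_def)
      ultimately show "?F (r, c) < ?F (s, c)"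
        using e_mono by (simp add: append_run_def)
    qed
  qed
  ultimately show "?F \<in> fillings_on U (j + m) k"
    by (simp add: fillings_on_def)
  show "{j + 1..<j + m} \<subseteq> links k ?F"
  proof
    fix i assume i: "i \<in> {j + 1..<j + m}"
    then have "(k, i) \<in> tail_cells j m k" "(1, i + 1) \<in> tail_cells j m k"
      using k by (auto simp: tail_cells_def)
    moreover have "i - j = Suc (i - Suc j)"
      using i by auto
    then have "tail_index j k (k, i) < tail_index j k (1, i + 1)"
      using k by (simp add: tail_index_def)
    ultimately show "i \<in> links k ?F"
      using e_mono by (simp add: links_def append_run_def)
  qed
qed

lemma sum_final_run:
  fixes g :: "(nat \<times> nat \<Rightarrow> nat) \<Rightarrow> 'a :: field_char_0"
  assumes k: "k \<ge> 1" and U: "finite U" "card U = k * (j + m)"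
  shows "(\<Sum>F | F \<in> fillings_on U (j + m) k \<and> {j + 1..<j + m} \<subseteq> links k F.
            g (restrict F (cells j k)))
       = (\<Sum>V | V \<subseteq> U \<and> card V = k * j. \<Sum>G\<in>fillings_on V j k. g G)"
proof -
  let ?Vs = "{V. V \<subseteq> U \<and> card V = k * j}"
  have cardD: "card (U - V) = k * m" if "V \<subseteq> U" "card V = k * j" for V
    using that U by (simp add: card_Diff_subset finite_subset algebra_simps)
  have "(\<Sum>F | F \<in> fillings_on U (j + m) k \<and> {j + 1..<j + m} \<subseteq> links k F.
            g (restrict F (cells j k)))
      = (\<Sum>(V, G) \<in> Sigma ?Vs (\<lambda>V. fillings_on V j k). g G)"
  proof (rule sum.reindex_bij_witness[of _ "\<lambda>(V, G). append_run j m k (U - V) G"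
        "\<lambda>F. (F ` cells j k, restrict F (cells j k))"])
    fix F assume "F \<in> {F. F \<in> fillings_on U (j + m) k \<and> {j + 1..<j + m} \<subseteq> links k F}"
    then have F: "F \<in> fillings_on U (j + m) k" and run: "{j + 1..<j + m} \<subseteq> links k F"
      by auto
    then have bij: "bij_betw F (cells (j + m) k) U" and ext: "F \<in> extensional (cells (j + m) k)"
      by (auto simp: fillings_on_def)
    have inj: "inj_on F (cells (j + m) k)" and img: "F ` cells (j + m) k = U"
      using bij by (auto simp: bij_betw_def)
    let ?V = "F ` cells j k"
    have injV: "inj_on F (cells j k)"
      using inj by (rule inj_on_subset) (simp add: cells_add)
    have VU: "?V \<subseteq> U"
      using img by (auto simp: cells_add)
    have cV: "card ?V = k * j"
      by (simp add: card_image[OF injV])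
    have bV: "bij_betw (restrict F (cells j k)) (cells j k) ?V"
      using injV by (auto simp: bij_betw_def inj_on_def)
    have "strict_mono_on {1..k} (\<lambda>r. restrict F (cells j k) (r, c))" if "c \<in> {1..j}" for c
      using F that by (auto simp: strict_mono_on_def fillings_on_def cells_def)
    with bV have "restrict F (cells j k) \<in> fillings_on ?V j k"
      by (simp add: fillings_on_def)
    then show "(?V, restrict F (cells j k)) \<in> Sigma ?Vs (\<lambda>V. fillings_on V j k)"
      using VU cV by simp
    show "(case (?V, restrict F (cells j k)) of (V, G) \<Rightarrow> g G) = g (restrict F (cells j k))"
      by simp
    have "F ` tail_cells j m k = F ` (cells (j + m) k - cells j k)"
      using cells_disjoint[of j k m] by (intro arg_cong[of _ _ "image F"]) (auto simp: cells_add)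
    also have "\<dots> = U - ?V"
      using inj_on_image_set_diff[OF inj, of "cells (j + m) k" "cells j k"] img
      by (simp add: cells_add)
    finally have tail: "F ` tail_cells j m k = U - ?V" .
    have "(\<lambda>p. F (tail_cell j k p)) ` {..<k * m} = U - ?V"
      using bij_betw_tail_cell[OF k, of j m] tail
      by (simp add: bij_betw_def flip: image_image)
    note nth = strict_mono_on_eq_nth_sorted_list[OF run_strict_mono[OF k F run] this]
    have "append_run j m k (U - ?V) (restrict F (cells j k)) p = F p" for p
    proof (cases "p \<in> tail_cells j m k")
      case True
      then show ?thesis
        using nth[of "tail_index j k p"]
        by (simp add: append_run_def tail_index_less tail_cell_index)
    next
      case False
      then show ?thesis
        using extensional_arb[OF ext, of p] by (auto simp: append_run_def restrict_def cells_add)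
    qed
    then show "(case (?V, restrict F (cells j k)) of (V, G) \<Rightarrow> append_run j m k (U - V) G) = F"
      by auto
  next
    fix VG assume "VG \<in> Sigma ?Vs (\<lambda>V. fillings_on V j k)"
    then obtain V G where VG: "VG = (V, G)" and V: "V \<subseteq> U" "card V = k * j"
      and G: "G \<in> fillings_on V j k"
      by auto
    let ?F = "append_run j m k (U - V) G"
    have "?F ` cells j k = G ` cells j k"
      using cells_disjoint[of j k m] by (intro image_cong) (auto simp: append_run_def)
    moreover have "G ` cells j k = V"
      using G by (simp add: fillings_on_def bij_betw_def)
    moreover have "restrict ?F (cells j k) = G"
      using G cells_disjoint[of j k m]
      by (intro extensionalityI[of _ "cells j k"]) (auto simp: append_run_def fillings_on_def)
    ultimately show "((case VG of (V, G) \<Rightarrow> append_run j m k (U - V) G) ` cells j k,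
        restrict (case VG of (V, G) \<Rightarrow> append_run j m k (U - V) G) (cells j k)) = VG"
      by (simp add: VG)
    show "(case VG of (V, G) \<Rightarrow> append_run j m k (U - V) G)
        \<in> {F. F \<in> fillings_on U (j + m) k \<and> {j + 1..<j + m} \<subseteq> links k F}"
      using append_run_in_fillings_on[OF k V(1) U(1) cardD[OF V] G] by (simp add: VG)
  qed
  also have "\<dots> = (\<Sum>V\<in>?Vs. \<Sum>G\<in>fillings_on V j k. g G)"
    using U(1) by (subst sum.Sigma) (auto intro!: finite_fillings_on intro: finite_subset)
  finally show ?thesis .
qed

lemma sum_weight_final_run:
  assumes k: "k \<ge> 1"
  shows "(\<Sum>F | F \<in> fillings (j + m) k \<and> {j + 1..<j + m} \<subseteq> links k F. weight k x j F)
       = of_nat ((k * (j + m)) choose (k * j)) * (\<Sum>G\<in>fillings j k. weight k x j G)"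
proof -
  define U where "U = {1..k * (j + m)}"
  have U: "finite U" "card U = k * (j + m)"
    by (simp_all add: U_def)
  have wt: "weight k x j (restrict F (cells j k)) = weight k x j F" for F
  proof -
    have "links k (restrict F (cells j k)) \<inter> {1..<j} = links k F \<inter> {1..<j}"
      using k by (auto simp: links_def cells_def)
    then show ?thesis
      by (simp add: weight_def)
  qed
  have "(\<Sum>F | F \<in> fillings (j + m) k \<and> {j + 1..<j + m} \<subseteq> links k F. weight k x j F)
      = (\<Sum>F | F \<in> fillings_on U (j + m) k \<and> {j + 1..<j + m} \<subseteq> links k F.
           weight k x j (restrict F (cells j k)))"
    by (simp add: wt fillings_eq_fillings_on U_def)
  also have "\<dots> = (\<Sum>V | V \<subseteq> U \<and> card V = k * j. \<Sum>G\<in>fillings_on V j k. weight k x j G)"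
    by (rule sum_final_run[OF k U])
  also have "\<dots> = (\<Sum>V | V \<subseteq> U \<and> card V = k * j. \<Sum>G\<in>fillings j k. weight k x j G)"
    using k U(1) by (intro sum.cong sum_weight_fillings_on_eq) (auto intro: finite_subset)
  also have "\<dots> = of_nat ((k * (j + m)) choose (k * j)) * (\<Sum>G\<in>fillings j k. weight k x j G)"
    using n_subsets[OF U(1), of "k * j"] U(2) by simp
  finally show ?thesis .
qed

section \<open>The recurrence\<close>

text \<open>The summand for \<open>j\<close> belongs to the first \<open>j\<close> columns, followed by a run of length \<open>n - j\<close>.
  The identity holds for any set \<open>M\<close> of positions: reading them from the right, write the factor of
  each position in \<open>M\<close> as \<open>x = 1 + (x - 1)\<close>; the choice of \<open>1\<close> ends the run there, the choice of
  \<open>x - 1\<close> extends it by a column.\<close>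

lemma power_card_run_expansion:
  fixes x :: "'a :: field_char_0"
  assumes "n \<ge> 1"
  shows "x ^ card (M \<inter> {1..<n}) =
    (\<Sum>j<n. (x - 1) ^ (n - 1 - j) *
       (if {j + 1..<n} \<subseteq> M then x ^ card (M \<inter> {1..<j}) else 0))"
  using assms
proof (induction n rule: dec_induct)
  case base
  then show ?case by simp
next
  case (step n)
  let ?S = "\<lambda>n. \<Sum>j<n. (x - 1) ^ (n - 1 - j) *
       (if {j + 1..<n} \<subseteq> M then x ^ card (M \<inter> {1..<j}) else 0)"
  have sub: "{j + 1..<Suc n} \<subseteq> M \<longleftrightarrow> n \<in> M \<and> {j + 1..<n} \<subseteq> M" if "j < n" for j
    using that by (auto simp: less_Suc_eq)
  have "?S (Suc n) = (\<Sum>j<n. (x - 1) ^ (n - j) *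
       (if {j + 1..<Suc n} \<subseteq> M then x ^ card (M \<inter> {1..<j}) else 0)) + x ^ card (M \<inter> {1..<n})"
    by simp
  also have "(\<Sum>j<n. (x - 1) ^ (n - j) *
       (if {j + 1..<Suc n} \<subseteq> M then x ^ card (M \<inter> {1..<j}) else 0))
     = (if n \<in> M then x - 1 else 0) * ?S n"
    unfolding sum_distrib_left
  proof (rule sum.cong[OF refl])
    fix j assume "j \<in> {..<n}"
    then have j: "j < n" by simp
    then have "n - j = Suc (n - 1 - j)" by simp
    then show "(x - 1) ^ (n - j) *
        (if {j + 1..<Suc n} \<subseteq> M then x ^ card (M \<inter> {1..<j}) else 0) =
      (if n \<in> M then x - 1 else 0) * ((x - 1) ^ (n - 1 - j) *
        (if {j + 1..<n} \<subseteq> M then x ^ card (M \<inter> {1..<j}) else 0))"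
      unfolding sub[OF j] by auto
  qed
  also have "?S n = x ^ card (M \<inter> {1..<n})"
    by (rule step.IH[symmetric])
  also have "(if n \<in> M then x - 1 else 0) * x ^ card (M \<inter> {1..<n}) + x ^ card (M \<inter> {1..<n})
      = x ^ card (M \<inter> {1..<Suc n})"
  proof -
    have "{1..<Suc n} = insert n {1..<n}"
      using step.hyps by auto
    then show ?thesis
      by (auto simp: Int_insert_right algebra_simps)
  qed
  finally show ?case ..
qed

lemma sum_weight_recurrence:
  fixes x :: "'a :: field_char_0"
  assumes k: "k \<ge> 1" and n: "n \<ge> 1"
  shows "(\<Sum>F\<in>fillings n k. weight k x n F) =
    (\<Sum>j<n. (x - 1) ^ (n - 1 - j) * (of_nat ((k * n) choose (k * j)) *
       (\<Sum>F\<in>fillings j k. weight k x j F)))"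
proof -
  have "(\<Sum>F\<in>fillings n k. weight k x n F) = (\<Sum>F\<in>fillings n k. \<Sum>j<n. (x - 1) ^ (n - 1 - j) *
       (if {j + 1..<n} \<subseteq> links k F then weight k x j F else 0))"
    unfolding weight_def by (subst power_card_run_expansion[OF n]) (rule refl)
  also have "\<dots> = (\<Sum>j<n. (x - 1) ^ (n - 1 - j) *
      (\<Sum>F\<in>fillings n k. if {j + 1..<n} \<subseteq> links k F then weight k x j F else 0))"
    by (subst sum.swap) (simp add: sum_distrib_left)
  also have "\<dots> = (\<Sum>j<n. (x - 1) ^ (n - 1 - j) *
      (\<Sum>F | F \<in> fillings n k \<and> {j + 1..<n} \<subseteq> links k F. weight k x j F))"
    by (simp add: sum.If_cases finite_fillings Int_def)
  also have "\<dots> = (\<Sum>j<n. (x - 1) ^ (n - 1 - j) * (of_nat ((k * n) choose (k * j)) *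
       (\<Sum>F\<in>fillings j k. weight k x j F)))"
  proof (intro sum.cong[OF refl] arg_cong2[of _ _ _ _ "(*)"] refl)
    fix j assume "j \<in> {..<n}"
    then have "n = j + (n - j)" by simp
    then show "(\<Sum>F | F \<in> fillings n k \<and> {j + 1..<n} \<subseteq> links k F. weight k x j F) =
        of_nat ((k * n) choose (k * j)) * (\<Sum>F\<in>fillings j k. weight k x j F)"
      using sum_weight_final_run[OF k, where j = j and m = "n - j" and x = x] by simp
  qed
  finally show ?thesis .
qed

section \<open>The generating function\<close>

lemma fps_nth_D_series:
  assumes "k \<ge> 1" "P \<in> standard_two_col k" "(\<lambda>r. P (r, 1)) ` {1..k} = {1..k}"
  shows "D_series k P x $ n = (\<Sum>F\<in>fillings n k. weight k x n F) / fact (k * n)"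
proof -
  have "(\<Sum>F\<in>fillings n k. x ^ mch n k P F) = (\<Sum>F\<in>fillings n k. weight k x n F)"
    by (intro sum.cong) (simp_all add: weight_def mch_eq_card_links[OF assms])
  moreover have "fillings 0 k = {\<lambda>_. undefined}"
    by (auto simp: fillings_def cells_def bij_betw_def)
  ultimately show ?thesis
    by (auto simp: D_series_def weight_def)
qed

lemma D_series_eq:
  fixes x :: "'a :: field_char_0"
  assumes k: "k \<ge> 1" and P: "P \<in> standard_two_col k" "(\<lambda>r. P (r, 1)) ` {1..k} = {1..k}"
    and x: "x \<noteq> 1"
  shows "D_series k P x =
           fps_const (1 - x) /
             (fps_const (1 - x) + fps_const ((x - 1) / fact k) * fps_X
               + Abs_fps (\<lambda>n. if n \<ge> 2 then (x - 1) ^ n / fact (k * n) else 0))"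
    (is "_ = _ / ?E")
proof -
  let ?D = "D_series k P x"
  define S :: "'a fps" where
    "S = Abs_fps (\<lambda>m. if m = 0 then 0 else (x - 1) ^ (m - 1) / fact (k * m))"
  note nth = fps_nth_D_series[OF k P, of x]
  \<comment> \<open>Division by the factorials turns the recurrence into a convolution with \<open>S\<close>.\<close>
  have D: "?D = 1 + ?D * S"
  proof (rule fps_ext)
    fix n
    show "?D $ n = (1 + ?D * S) $ n"
    proof (cases "n = 0")
      case True
      then show ?thesis by (simp add: S_def D_series_def)
    next
      case False
      have "?D $ n = (\<Sum>j<n. (x - 1) ^ (n - 1 - j) * (of_nat ((k * n) choose (k * j)) *
         (\<Sum>F\<in>fillings j k. weight k x j F)) / fact (k * n))"
        using sum_weight_recurrence[OF k, of n x] False by (simp add: nth sum_divide_distrib)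
      also have "\<dots> = (\<Sum>j<n. ?D $ j * S $ (n - j))"
      proof (rule sum.cong[OF refl])
        fix j assume "j \<in> {..<n}"
        then have j: "j < n" by simp
        have "of_nat ((k * n) choose (k * j)) = (fact (k * n) / (fact (k * j) * fact (k * (n - j))) :: 'a)"
          using j by (simp add: binomial_fact diff_mult_distrib2)
        then show "(x - 1) ^ (n - 1 - j) * (of_nat ((k * n) choose (k * j)) *
           (\<Sum>F\<in>fillings j k. weight k x j F)) / fact (k * n) = ?D $ j * S $ (n - j)"
          using j by (simp add: S_def nth)
      qed
      also have "\<dots> = (\<Sum>j=0..n. ?D $ j * S $ (n - j))"
        by (rule sum.mono_neutral_left) (auto simp: S_def)
      also have "\<dots> = (1 + ?D * S) $ n"
        using False by (simp add: fps_mult_nth)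
      finally show ?thesis .
    qed
  qed
  have E: "?E = fps_const (1 - x) * (1 - S)"
  proof (rule fps_ext)
    fix n
    consider "n = 0" | "n = 1" | m where "n = Suc (Suc m)"
      by (metis One_nat_def not0_implies_Suc)
    then show "?E $ n = (fps_const (1 - x) * (1 - S)) $ n"
      by cases (simp_all add: S_def fps_X_def field_simps)
  qed
  have "?D * ?E = fps_const (1 - x) * (?D - ?D * S)"
    unfolding E by (simp add: algebra_simps)
  also have "\<dots> = fps_const (1 - x)"
    by (subst (1) D) simp
  finally have DE: "?D * ?E = fps_const (1 - x)" .
  have E0: "?E $ 0 \<noteq> 0"
    using x by simp
  then have "?E \<noteq> 0"
    by (metis fps_zero_nth)
  then show ?thesis
    by (metis DE nonzero_mult_div_cancel_right)
qed

lemma indet_neq_one: "indet \<noteq> 1"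
proof
  assume "indet = 1"
  then have "to_fract [:0, 1:] = to_fract (1 :: rat poly)"
    by (simp add: indet_def)
  then show False
    by (simp only: to_fract_eq_iff) (simp add: one_pCons)
qed

theorem corollary5:
  fixes k :: nat and P :: "nat \<times> nat \<Rightarrow> nat"
  assumes "k \<ge> 1"
    and "P \<in> standard_two_col k"
    and "(\<lambda>r. P (r, 1)) ` {1..k} = {1..k}"
  shows "D_series k P indet =
           fps_const (1 - indet) /
             (fps_const (1 - indet) + fps_const ((indet - 1) / fact k) * fps_X
               + Abs_fps (\<lambda>n. if n \<ge> 2 then (indet - 1) ^ n / fact (k * n) else 0))
    \<and> A_series k P =
           1 / (1 - fps_const (1 / fact k) * fps_X
               + Abs_fps (\<lambda>n. if n \<ge> 2 then (- 1) ^ n / fact (k * n) else 0))"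
proof
  show "D_series k P indet =
           fps_const (1 - indet) /
             (fps_const (1 - indet) + fps_const ((indet - 1) / fact k) * fps_X
               + Abs_fps (\<lambda>n. if n \<ge> 2 then (indet - 1) ^ n / fact (k * n) else 0))"
    by (rule D_series_eq[OF assms indet_neq_one])
  have neg: "1 + fps_const (- 1 / fact k) * fps_X = 1 - fps_const (1 / fact k :: rat) * fps_X"
    by (simp flip: fps_const_neg)
  show "A_series k P =
           1 / (1 - fps_const (1 / fact k) * fps_X
               + Abs_fps (\<lambda>n. if n \<ge> 2 then (- 1) ^ n / fact (k * n) else 0))"
    unfolding A_series_eq_D_series_0 D_series_eq[OF assms zero_neq_one] diff_0_right
      fps_const_1_eq_1 neg diff_0 ..
qed

end
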